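(* Let $\mathbf{A}$ be an algebra which satisfies some non-trivial loop condition of width $m\geq 2$. Then $\mathbf{A}$ satisfies the loop condition $L^m_{\max(4,m +1)}$.
   Context: A loop condition of arity $n\ge 1$ and width $m\ge 2$ is a set of identities of the form $f(x_{1,1},\ldots,x_{1,n})\approx f(x_{2,1},\ldots,x_{2,n})\approx\cdots\approx f(x_{m,1},\ldots,x_{m,n})$, where $f$ is an $n$-ary function symbol and each $x_{i,j}$ is a variable from some finite set $V$. An algebra satisfies the loop condition if it has an $n$-ary term operation $f$ for which these equations hold for all values of the variables in its domain. A set of identities is non-trivial if it cannot be satisfied in any algebra on an at least two-element domain whose only fundamental operations are projections. For $k,m\ge 2$, let $\mathbb{K}^m_k$ be the $m$-ary relation $\{(x_1,\dots,x_m)\in\{1,\dots,k\}^m \mid x_i\neq x_j \text{ for some } i,j\}$. The loop condition $L^m_k$ is $f(r_{1,1},\ldots,r_{1,N})\approx f(r_{2,1},\ldots,r_{2,N})\approx\cdots\approx f(r_{m,1},\ldots,r_{m,N})$, where $N=k^m-k$, $(r_{1,1},\ldots,r_{m,1}),\ldots,(r_{1,N},\ldots,r_{m,N})$ is an enumeration of the tuples of $\mathbb{K}^m_k$, and the elements of $\{1,\dots,k\}$ are regarded as variables (the choice of enumeration is irrelevant for satisfaction). *)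

theory Defs
  imports Main
begin

section \<open>Algebras and term operations\<close>

text \<open>
  The domain and the set of operation symbols are sets inside the respective types, so that
  every domain and every signature (also the empty one) can occur. Arity \<open>0\<close> is allowed.
  A tuple of length \<open>n\<close> is a list of length \<open>n\<close>, with entries numbered from \<open>0\<close>.
\<close>

record ('f, 'a) ualg =
  domain :: "'a set"
  symbols :: "'f set"
  op_arity :: "'f \<Rightarrow> nat"
  op_interp :: "'f \<Rightarrow> 'a list \<Rightarrow> 'a"

definition is_algebra :: "('f, 'a) ualg \<Rightarrow> bool" where
  "is_algebra A \<longleftrightarrow>
     domain A \<noteq> {} \<and>
     (\<forall>s\<in>symbols A. \<forall>as. length as = op_arity A s \<and> set as \<subseteq> domain A \<longrightarrow>
        op_interp A s as \<in> domain A)"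

datatype 'f trm = Var nat | App 'f "'f trm list"

inductive is_term :: "('f, 'a) ualg \<Rightarrow> nat \<Rightarrow> 'f trm \<Rightarrow> bool"
  for A :: "('f, 'a) ualg" and n :: nat where
  Var: "i < n \<Longrightarrow> is_term A n (Var i)"
| App: "s \<in> symbols A \<Longrightarrow> length ts = op_arity A s \<Longrightarrow> (\<And>t. t \<in> set ts \<Longrightarrow> is_term A n t)
    \<Longrightarrow> is_term A n (App s ts)"

primrec eval_term :: "('f, 'a) ualg \<Rightarrow> 'a list \<Rightarrow> 'f trm \<Rightarrow> 'a" where
  "eval_term A as (Var i) = as ! i"
| "eval_term A as (App s ts) = op_interp A s (map (eval_term A as) ts)"

text \<open>Only the values of \<open>f\<close> on \<open>n\<close>-tuples over the domain matter.\<close>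

definition term_operation :: "('f, 'a) ualg \<Rightarrow> nat \<Rightarrow> ('a list \<Rightarrow> 'a) \<Rightarrow> bool" where
  "term_operation A n f \<longleftrightarrow>
     (\<exists>t. is_term A n t \<and>
       (\<forall>as. length as = n \<and> set as \<subseteq> domain A \<longrightarrow> f as = eval_term A as t))"

section \<open>Loop conditions\<close>

text \<open>
  A loop condition is given by the list of its rows: the row \<open>[x\<^bsub>i,1\<^esub>, \<dots>, x\<^bsub>i,n\<^esub>]\<close> stands for
  the term \<open>f(x\<^bsub>i,1\<^esub>, \<dots>, x\<^bsub>i,n\<^esub>)\<close>. The variables are elements of \<open>'v\<close>; only
  finitely many of them occur.
\<close>

definition loop_condition :: "nat \<Rightarrow> nat \<Rightarrow> 'v list list \<Rightarrow> bool" where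
  "loop_condition n m C \<longleftrightarrow>
     n \<ge> 1 \<and> m \<ge> 2 \<and> length C = m \<and> (\<forall>r\<in>set C. length r = n)"

abbreviation loop_arity :: "'v list list \<Rightarrow> nat" where
  "loop_arity C \<equiv> length (hd C)"

definition satisfies :: "('f, 'a) ualg \<Rightarrow> 'v list list \<Rightarrow> bool" where
  "satisfies A C \<longleftrightarrow>
     (\<exists>f. term_operation A (loop_arity C) f \<and>
       (\<forall>\<alpha>. range \<alpha> \<subseteq> domain A \<longrightarrow>
         (\<forall>r\<in>set C. \<forall>r'\<in>set C. f (map \<alpha> r) = f (map \<alpha> r'))))"

definition projection_algebra :: "('f, 'a) ualg \<Rightarrow> bool" where
  "projection_algebra A \<longleftrightarrow>
     is_algebra A \<and>
     (\<forall>s\<in>symbols A. \<exists>i<op_arity A s.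
        \<forall>as. length as = op_arity A s \<and> set as \<subseteq> domain A \<longrightarrow> op_interp A s as = as ! i)"

text \<open>
  A definition in HOL cannot quantify over types, so the algebras here have their domain and
  their symbols among the natural numbers. Lemma \<open>nontrivial_every_type\<close> below shows that
  this gives the same notion as the quantification over algebras of all types.
\<close>

definition nontrivial :: "'v list list \<Rightarrow> bool" where
  "nontrivial C \<longleftrightarrow>
     \<not> (\<exists>A :: (nat, nat) ualg. projection_algebra A \<and>
          (\<exists>a\<in>domain A. \<exists>b\<in>domain A. a \<noteq> b) \<and> satisfies A C)"

lemma projection_algebra_term:
  assumes "projection_algebra A" and "is_term A n t"
  shows "\<exists>i<n. \<forall>as. length as = n \<and> set as \<subseteq> domain A \<longrightarrow> eval_term A as t = as ! i"
  using assms(2)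
proof induction
  case (Var i)
  then show ?case by auto
next
  case (App s ts)
  obtain j where j: "j < op_arity A s" and
    p: "\<And>as. length as = op_arity A s \<Longrightarrow> set as \<subseteq> domain A \<Longrightarrow> op_interp A s as = as ! j"
    using assms(1) App.hyps(1) unfolding projection_algebra_def by blast
  have "ts ! j \<in> set ts" using j App.hyps(2) by simp
  then obtain i where i: "i < n" and
    e: "\<And>as. length as = n \<Longrightarrow> set as \<subseteq> domain A \<Longrightarrow> eval_term A as (ts ! j) = as ! i"
    using App.IH by blast
  have "eval_term A as (App s ts) = as ! i" if as: "length as = n" "set as \<subseteq> domain A" for as
  proof -
    have "eval_term A as t \<in> domain A" if t: "t \<in> set ts" for t
    proof -
      obtain k where "k < n" "eval_term A as t = as ! k"
        using App.IH[OF t] as by blast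
      then show ?thesis using as by (metis nth_mem subsetD)
    qed
    then have "set (map (eval_term A as) ts) \<subseteq> domain A" by auto
    then have "eval_term A as (App s ts) = map (eval_term A as) ts ! j"
      using p[of "map (eval_term A as) ts"] App.hyps(2) by simp
    then show ?thesis using j e[OF as] App.hyps(2) by simp
  qed
  then show ?case using i by blast
qed

lemma nontrivial_every_type:
  fixes B :: "('g, 'b) ualg"
  assumes C: "loop_condition n m C" and nt: "nontrivial C"
    and B: "projection_algebra B" and ab: "a \<in> domain B" "b \<in> domain B" "a \<noteq> b"
  shows "\<not> satisfies B C"
proof
  assume "satisfies B C"
  have ne: "C \<noteq> []" and rl: "\<And>r. r \<in> set C \<Longrightarrow> length r = n"
    using C unfolding loop_condition_def by auto
  then have n: "loop_arity C = n" by simp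
  obtain f where f: "term_operation B n f" and
    eq: "\<And>\<alpha> r r'. range \<alpha> \<subseteq> domain B \<Longrightarrow> r \<in> set C \<Longrightarrow> r' \<in> set C \<Longrightarrow> f (map \<alpha> r) = f (map \<alpha> r')"
    using \<open>satisfies B C\<close> unfolding satisfies_def n by blast
  obtain t where t: "is_term B n t" and
    ft: "\<And>as. length as = n \<Longrightarrow> set as \<subseteq> domain B \<Longrightarrow> f as = eval_term B as t"
    using f unfolding term_operation_def by blast
  obtain i where i: "i < n" and
    ti: "\<And>as. length as = n \<Longrightarrow> set as \<subseteq> domain B \<Longrightarrow> eval_term B as t = as ! i"
    using projection_algebra_term[OF B t] by blast
  have fi: "f (map \<alpha> r) = \<alpha> (r ! i)" if "range \<alpha> \<subseteq> domain B" "r \<in> set C" for \<alpha> r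
  proof -
    have "set (map \<alpha> r) \<subseteq> domain B" using that by auto
    then show ?thesis using ft[of "map \<alpha> r"] ti[of "map \<alpha> r"] rl[OF that(2)] i by simp
  qed
  have col: "r ! i = r' ! i" if r: "r \<in> set C" "r' \<in> set C" for r r'
  proof (rule ccontr)
    assume d: "r ! i \<noteq> r' ! i"
    define \<alpha> where "\<alpha> v = (if v = r ! i then a else b)" for v
    have "range \<alpha> \<subseteq> domain B" using ab by (auto simp: \<alpha>_def)
    from eq[OF this r] fi[OF this r(1)] fi[OF this r(2)] show False
      using d ab by (simp add: \<alpha>_def)
  qed
  define N :: "(nat, nat) ualg" where
    "N = \<lparr>domain = UNIV, symbols = {}, op_arity = (\<lambda>_. 0), op_interp = (\<lambda>_ _. 0)\<rparr>"
  have "projection_algebra N" by (simp add: N_def projection_algebra_def is_algebra_def)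
  moreover have "\<exists>x\<in>domain N. \<exists>y\<in>domain N. x \<noteq> y"
    by (rule bexI[of _ 0], rule bexI[of _ 1]) (simp_all add: N_def)
  moreover have "satisfies N C"
    unfolding satisfies_def n
  proof (intro exI conjI allI impI ballI)
    show "term_operation N n (\<lambda>as. as ! i)"
      unfolding term_operation_def using i by (intro exI[of _ "Var i"]) (auto intro: is_term.Var)
    fix \<alpha> :: "_ \<Rightarrow> nat" and r r' assume r: "r \<in> set C" "r' \<in> set C"
    show "map \<alpha> r ! i = map \<alpha> r' ! i" using r rl i col[OF r] by simp
  qed
  ultimately show False using nt unfolding nontrivial_def by blast
qed

section \<open>The loop conditions \<open>L\<^sup>m\<^sub>k\<close>\<close>

definition K_rel :: "nat \<Rightarrow> nat \<Rightarrow> nat list set" where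
  "K_rel m k =
     {x. length x = m \<and> set x \<subseteq> {1..k} \<and> (\<exists>i<m. \<exists>j<m. x ! i \<noteq> x ! j)}"

text \<open>The tuples in \<open>cs\<close> become the columns of the loop condition.\<close>

definition rows_of_columns :: "nat \<Rightarrow> 'v list list \<Rightarrow> 'v list list" where
  "rows_of_columns m cs = map (\<lambda>i. map (\<lambda>c. c ! i) cs) [0..<m]"

text \<open>There is one condition for each enumeration of \<open>K_rel m k\<close> without repetitions.\<close>

definition L_conditions :: "nat \<Rightarrow> nat \<Rightarrow> nat list list set" where
  "L_conditions m k = {rows_of_columns m cs | cs. distinct cs \<and> set cs = K_rel m k}"

lemma finite_K_rel: "finite (K_rel m k)"
  by (rule finite_subset[OF _ finite_lists_length_eq[of "{1..k}" m]]) (auto simp: K_rel_def)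

lemma L_conditions_nonempty: "L_conditions m k \<noteq> {}"
  using finite_distinct_list[OF finite_K_rel[of m k]] by (auto simp: L_conditions_def)

lemma card_K_rel:
  assumes "m \<ge> 2"
  shows "card (K_rel m k) = k ^ m - k"
proof -
  let ?T = "{x. set x \<subseteq> {1..k} \<and> length x = m}"
  let ?D = "replicate m ` {1..k}"
  have "x \<in> ?D" if x: "x \<in> ?T" "x \<notin> K_rel m k" for x
  proof -
    have "x ! i = x ! 0" if "i < m" for i
    proof -
      have "0 < m" using that by simp
      then show ?thesis using x that unfolding K_rel_def by blast
    qed
    then have "\<forall>y\<in>set x. y = x ! 0" using x(1) by (auto simp: in_set_conv_nth)
    then have "x = replicate m (x ! 0)" using x(1) replicate_eqI[of x m "x ! 0"] by blast
    moreover have "x ! 0 \<in> {1..k}"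
    proof -
      have "set x \<subseteq> {1..k}" "x ! 0 \<in> set x" using x(1) assms by simp_all
      then show ?thesis by blast
    qed
    ultimately show ?thesis by blast
  qed
  moreover have "K_rel m k \<subseteq> ?T" by (auto simp: K_rel_def)
  moreover have "x \<notin> ?D" if "x \<in> K_rel m k" for x
  proof
    assume "x \<in> ?D"
    then obtain a where "x = replicate m a" by blast
    then have "x ! i = a" if "i < m" for i using that by simp
    then show False using that unfolding K_rel_def by blast
  qed
  ultimately have "K_rel m k = ?T - ?D" by blast
  moreover have "card ?D = k" using assms by (subst card_image) (auto simp: inj_on_def)
  moreover have "?D \<subseteq> ?T" by auto
  moreover have "card ?T = k ^ m" using card_lists_length_eq[of "{1..k}" m] by simp
  ultimately show ?thesis by (simp add: card_Diff_subset)
qed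

lemma L_conditions_loop_condition:
  assumes "m \<ge> 2" and "k \<ge> 2" and "C \<in> L_conditions m k"
  shows "loop_condition (k ^ m - k) m C"
proof -
  obtain cs where cs: "C = rows_of_columns m cs" "distinct cs" "set cs = K_rel m k"
    using assms(3) by (auto simp: L_conditions_def)
  have "length cs = k ^ m - k"
    using cs card_K_rel[OF assms(1)] by (metis distinct_card)
  moreover have "k ^ 1 < k ^ m" using assms by (intro power_strict_increasing) auto
  ultimately show ?thesis using assms(1) cs(1)
    by (auto simp: loop_condition_def rows_of_columns_def)
qed

end

theory Submission
  imports Defs
begin

text \<open>
  Since the columns of a non-trivial condition are not constant, an injection of its variables
  into \<open>{1..K}\<close> maps them into \<open>K_rel m K\<close>, so \<open>L\<^sup>m\<^sub>K\<close> holds for all large \<open>K\<close>. It remains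
  to descend from \<open>L\<^sup>m\<^bsub>k+1\<^esub>\<close> to \<open>L\<^sup>m\<^sub>k\<close> whenever \<open>k \<ge> m + 1\<close>.

  In relational terms, let \<open>R\<close> be a compatible relation containing \<open>K_rel m k\<close>. Encode
  \<open>a \<in> {1..k+1}\<close> by a pair \<open>(X a, Y a)\<close> of distinct elements of \<open>{1..k}\<close>. For a non-constant
  tuple \<open>e\<close> there are distinct \<open>c\<^sub>1, \<dots>, c\<^bsub>k-1\<^esub>\<close> such that \<open>c\<^sub>j\<close> avoids both \<open>X e\<^sub>j\<close> and
  \<open>Y e\<^bsub>j+1\<^esub>\<close>, with the indices of \<open>e\<close> taken modulo \<open>m\<close>. This is a primitive positive condition
  on \<open>m\<close>-tuples of pairs, and a constant tuple satisfying it consists of a pair that together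
  with the \<open>c\<^sub>j\<close> spans a copy of \<open>K_rel m (k+1)\<close> in \<open>R\<close>. Two uses of \<open>L\<^sup>m\<^bsub>k+1\<^esub>\<close> thus give a
  constant tuple in \<open>R\<close>.
\<close>

section \<open>Composition of term operations\<close>

lemma is_term_eval_in_domain:
  assumes "is_algebra A" and "is_term A n t" and "length as = n" and "set as \<subseteq> domain A"
  shows "eval_term A as t \<in> domain A"
  using assms(2)
proof induction
  case (Var i)
  then show ?case using assms(3,4) by (simp add: subsetD)
next
  case (App s ts)
  then have "set (map (eval_term A as) ts) \<subseteq> domain A" by auto
  then show ?case using assms(1) App.hyps unfolding is_algebra_def by simp
qed

lemma term_operation_in_domain:
  assumes "is_algebra A" and "term_operation A n f" and "length as = n" and "set as \<subseteq> domain A"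
  shows "f as \<in> domain A"
  using assms is_term_eval_in_domain unfolding term_operation_def by metis

lemma term_operation_nth:
  assumes "i < n"
  shows "term_operation A n (\<lambda>as. as ! i)"
  unfolding term_operation_def using assms by (intro exI[of _ "Var i"]) (auto intro: is_term.Var)

primrec subst_term :: "(nat \<Rightarrow> 'f trm) \<Rightarrow> 'f trm \<Rightarrow> 'f trm" where
  "subst_term \<theta> (Var i) = \<theta> i"
| "subst_term \<theta> (App s ts) = App s (map (subst_term \<theta>) ts)"

lemma is_term_subst_term:
  assumes "is_term A n t" and "\<And>i. i < n \<Longrightarrow> is_term A k (\<theta> i)"
  shows "is_term A k (subst_term \<theta> t)"
  using assms(1) by induction (auto simp: assms(2) intro!: is_term.App)

lemma eval_subst_term:
  assumes "is_term A n t"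
  shows "eval_term A as (subst_term \<theta> t) = eval_term A (map (\<lambda>i. eval_term A as (\<theta> i)) [0..<n]) t"
  using assms
proof induction
  case (App s ts)
  then have "map (eval_term A as \<circ> subst_term \<theta>) ts
    = map (eval_term A (map (\<lambda>i. eval_term A as (\<theta> i)) [0..<n])) ts" by simp
  then show ?case by (metis eval_term.simps(2) list.map_comp subst_term.simps(2))
qed simp

lemma term_operation_compose:
  assumes alg: "is_algebra A" and f: "term_operation A (length cs) f"
    and g: "\<And>c. c \<in> set cs \<Longrightarrow> term_operation A n (g c)"
  shows "term_operation A n (\<lambda>as. f (map (\<lambda>c. g c as) cs))"
proof -
  obtain t where t: "is_term A (length cs) t" and
    ft: "\<And>as. length as = length cs \<Longrightarrow> set as \<subseteq> domain A \<Longrightarrow> f as = eval_term A as t"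
    using f unfolding term_operation_def by blast
  have "\<forall>c\<in>set cs. \<exists>u. is_term A n u \<and>
    (\<forall>as. length as = n \<and> set as \<subseteq> domain A \<longrightarrow> g c as = eval_term A as u)"
    using g unfolding term_operation_def by blast
  then obtain u where u: "\<And>c. c \<in> set cs \<Longrightarrow> is_term A n (u c)" and
    gu: "\<And>c as. c \<in> set cs \<Longrightarrow> length as = n \<Longrightarrow> set as \<subseteq> domain A \<Longrightarrow> g c as = eval_term A as (u c)"
    by metis
  let ?\<theta> = "\<lambda>i. u (cs ! i)"
  have "is_term A n (subst_term ?\<theta> t)"
    using t by (rule is_term_subst_term) (simp add: u)
  moreover have "f (map (\<lambda>c. g c as) cs) = eval_term A as (subst_term ?\<theta> t)"
    if as: "length as = n" "set as \<subseteq> domain A" for as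
  proof -
    have "set (map (\<lambda>c. g c as) cs) \<subseteq> domain A"
      using term_operation_in_domain[OF alg g] as by auto
    then have "f (map (\<lambda>c. g c as) cs) = eval_term A (map (\<lambda>c. g c as) cs) t"
      using ft by simp
    moreover have "map (\<lambda>c. g c as) cs = map (\<lambda>i. eval_term A as (?\<theta> i)) [0..<length cs]"
      by (rule nth_equalityI) (simp_all add: gu as)
    ultimately show ?thesis by (simp only: eval_subst_term[OF t])
  qed
  ultimately show ?thesis unfolding term_operation_def by blast
qed

section \<open>Loop conditions given by their columns\<close>

lemma satisfies_rows_of_columns:
  assumes "m \<ge> 1"
  shows "satisfies A (rows_of_columns m cs) \<longleftrightarrow>
    (\<exists>f. term_operation A (length cs) f \<and>
      (\<forall>\<alpha>. range \<alpha> \<subseteq> domain A \<longrightarrow>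
        (\<forall>p<m. \<forall>q<m. f (map (\<lambda>c. \<alpha> (c ! p)) cs) = f (map (\<lambda>c. \<alpha> (c ! q)) cs))))"
proof -
  have "loop_arity (rows_of_columns m cs) = length cs"
    using assms by (simp add: rows_of_columns_def hd_map)
  moreover have "(\<forall>r\<in>set (rows_of_columns m cs). P r) \<longleftrightarrow> (\<forall>p<m. P (map (\<lambda>c. c ! p) cs))" for P
    by (auto simp: rows_of_columns_def)
  ultimately show ?thesis by (simp add: satisfies_def o_def)
qed

text \<open>The new operation feeds its argument at a position of \<open>map h c\<close> into
  argument \<open>c\<close> of \<open>f\<close>. Its rows under \<open>\<alpha>\<close> are then the
  rows of \<open>f\<close> under \<open>\<alpha> \<circ> h\<close>.\<close>

lemma satisfies_rows_of_columns_hom: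
  assumes alg: "is_algebra A" and m: "m \<ge> 1"
    and len: "\<And>c. c \<in> set cs \<Longrightarrow> length c = m"
    and hom: "\<And>c. c \<in> set cs \<Longrightarrow> map h c \<in> set ds"
    and sat: "satisfies A (rows_of_columns m cs)"
  shows "satisfies A (rows_of_columns m ds)"
proof -
  obtain f where f: "term_operation A (length cs) f" and
    eq: "\<And>\<alpha> p q. range \<alpha> \<subseteq> domain A \<Longrightarrow> p < m \<Longrightarrow> q < m \<Longrightarrow>
      f (map (\<lambda>c. \<alpha> (c ! p)) cs) = f (map (\<lambda>c. \<alpha> (c ! q)) cs)"
    using sat unfolding satisfies_rows_of_columns[OF m] by blast
  have "\<forall>c\<in>set cs. \<exists>i<length ds. ds ! i = map h c"
    using hom by (simp add: in_set_conv_nth)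
  then obtain idx where idx: "\<And>c. c \<in> set cs \<Longrightarrow> idx c < length ds \<and> ds ! idx c = map h c"
    by metis
  define g where "g as = f (map (\<lambda>c. as ! idx c) cs)" for as
  have "term_operation A (length ds) g"
    unfolding g_def using alg f by (rule term_operation_compose) (simp add: idx term_operation_nth)
  moreover have "g (map (\<lambda>c. \<alpha> (c ! p)) ds) = g (map (\<lambda>c. \<alpha> (c ! q)) ds)"
    if \<alpha>: "range \<alpha> \<subseteq> domain A" and pq: "p < m" "q < m" for \<alpha> p q
  proof -
    have "g (map (\<lambda>c. \<alpha> (c ! p)) ds) = f (map (\<lambda>c. (\<alpha> \<circ> h) (c ! p)) cs)" if "p < m" for p
      unfolding g_def using that by (intro arg_cong[of _ _ f] map_cong) (simp_all add: idx len)
    then show ?thesis using eq[of "\<alpha> \<circ> h" p q] \<alpha> pq by auto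
  qed
  ultimately show ?thesis unfolding satisfies_rows_of_columns[OF m] by blast
qed

section \<open>Systems of distinct representatives\<close>

text \<open>When \<open>i\<close> is added, fewer than \<open>card (S i)\<close> values have been
  used, so one is left for it.\<close>

lemma greedy_choice:
  assumes "finite J" and "\<And>j. j \<in> J \<Longrightarrow> card J \<le> card (S j)"
  shows "\<exists>c. inj_on c J \<and> (\<forall>j\<in>J. c j \<in> S j)"
  using assms
proof (induction J)
  case empty
  then show ?case by simp
next
  case (insert i J)
  have "card J \<le> card (S j)" if "j \<in> J" for j
    using insert.prems[of j] insert.hyps that by simp
  then obtain c where c: "inj_on c J" "\<forall>j\<in>J. c j \<in> S j" using insert.IH by blast
  have "card (c ` J) < card (S i)"
    using insert.prems[of i] insert.hyps card_image[OF c(1)] by simp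
  then have "\<not> S i \<subseteq> c ` J" using card_mono[of "c ` J" "S i"] insert.hyps by auto
  then obtain x where x: "x \<in> S i" "x \<notin> c ` J" by blast
  have "inj_on (c(i := x)) (insert i J)"
    using c(1) x(2) insert.hyps by (auto simp: inj_on_def)
  moreover have "\<forall>j\<in>insert i J. (c(i := x)) j \<in> S j" using c(2) x(1) by auto
  ultimately show ?case by blast
qed

text \<open>Each \<open>B - F l\<close> has at least \<open>card J - 1\<close> elements, so the
  greedy choice works outside \<open>i\<close> and \<open>j\<close> and leaves each of these two a
  free value. The union of \<open>B - F i\<close> and \<open>B - F j\<close> is
  \<open>B - (F i \<inter> F j)\<close>, in which at least two values stay free, so the last two
  choices can differ.\<close>

lemma choice_avoiding_pairs:
  fixes F :: "'j \<Rightarrow> 'b set"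
  assumes J: "finite J" and B: "card J < card B"
    and F: "\<And>l. l \<in> J \<Longrightarrow> finite (F l) \<and> card (F l) \<le> 2"
    and ij: "i \<in> J" "j \<in> J" "i \<noteq> j" "card (F i \<inter> F j) \<le> 1"
  shows "\<exists>c. inj_on c J \<and> (\<forall>l\<in>J. c l \<in> B - F l)"
proof -
  define J' where "J' = J - {i, j}"
  have J': "J = insert i (insert j J')" "i \<notin> J'" "j \<notin> J'" "finite J'"
    using ij J by (auto simp: J'_def)
  have card_J: "card J = card J' + 2" using J' ij(3) by simp
  have diff: "card J' + 1 \<le> card (B - F l)" if "l \<in> J" for l
    using diff_card_le_card_Diff[of "F l" B] F[OF that] B card_J by linarith
  obtain c where c: "inj_on c J'" "\<forall>l\<in>J'. c l \<in> B - F l"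
    using greedy_choice[OF J'(4), of "\<lambda>l. B - F l"] diff J'(1) by fastforce
  define U where "U = c ` J'"
  have U: "finite U" "card U = card J'"
    using J'(4) c(1) by (simp_all add: U_def card_image)
  have rest: "\<exists>x. x \<in> B - F l - U" if "l \<in> J" for l
    using diff_card_le_card_Diff[OF U(1), of "B - F l"] U(2) diff[OF that]
    by (metis all_not_in_conv card.empty le_add_diff_inverse not_less_eq_eq le_zero_eq
        diff_is_0_eq Suc_eq_plus1)
  have "2 \<le> card (B - (F i \<inter> F j) - U)"
    using diff_card_le_card_Diff[OF U(1), of "B - (F i \<inter> F j)"]
      diff_card_le_card_Diff[of "F i \<inter> F j" B] F[OF ij(1)] U(2) B card_J ij(4) by simp
  moreover have "card (B - (F i \<inter> F j) - U) \<le> 1" if "B - (F i \<inter> F j) - U \<subseteq> {x}" for x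
    using card_mono[OF _ that] by simp
  ultimately have two: "\<not> B - (F i \<inter> F j) - U \<subseteq> {x}" for x by force
  obtain p q where pq: "p \<in> B - F i - U" "q \<in> B - F j - U" "p \<noteq> q"
    using rest[OF ij(1)] rest[OF ij(2)] two by blast
  have "inj_on (c(i := p, j := q)) J"
    using c(1) pq J' ij(3) unfolding J'(1) U_def by (auto simp: inj_on_def)
  moreover have "\<forall>l\<in>J. (c(i := p, j := q)) l \<in> B - F l"
    using c(2) pq J' by auto
  ultimately show ?thesis by blast
qed

section \<open>Crossing pairs of a cyclic tuple\<close>

text \<open>By \<open>meet\<close>, all sets \<open>{x l, y (Suc l mod m)}\<close> are one and the
  same two-element set. What remains is to exclude that \<open>x\<close> and \<open>y\<close> swap
  roles along the cycle.\<close>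

lemma crossing_pairs_constant:
  fixes x y :: "nat \<Rightarrow> 'b"
  assumes m: "m \<ge> 2" and xy: "\<And>l. l < m \<Longrightarrow> x l \<noteq> y l"
    and meet: "\<And>l l'. l < m \<Longrightarrow> l' < m \<Longrightarrow> l \<noteq> l' \<Longrightarrow>
      card ({x l, y (Suc l mod m)} \<inter> {x l', y (Suc l' mod m)}) \<ge> 2"
    and l: "l < m"
  shows "x l = x 0 \<and> y l = y 0"
proof -
  define F where "F l = {x l, y (Suc l mod m)}" for l
  have card_F: "finite (F l)" "card (F l) \<le> 2" for l
    by (simp_all add: F_def card_insert_if)
  have sub: "card (F l) = 2 \<and> F l \<subseteq> F l'" if "l < m" "l' < m" "l \<noteq> l'" for l l'
  proof -
    have "card (F l \<inter> F l') \<ge> 2" using meet[OF that] by (simp add: F_def)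
    moreover have "card (F l \<inter> F l') \<le> card (F l)" by (rule card_mono) (simp_all add: card_F)
    ultimately have "card (F l) = 2" "card (F l \<inter> F l') = card (F l)"
      using card_F(2)[of l] by linarith+
    then have "F l \<inter> F l' = F l" using card_F(1) by (intro card_subset_eq) simp_all
    then show ?thesis using \<open>card (F l) = 2\<close> by blast
  qed
  have F: "F l = F 0" if "l < m" for l
  proof (cases "l = 0")
    case False
    then show ?thesis using sub[of l 0] sub[of 0 l] that by blast
  qed simp
  have "card (F 0) = 2" using sub[of 0 1] m by simp
  then have neq: "x 0 \<noteq> y (Suc 0 mod m)" unfolding F_def by (metis card_2_iff doubleton_eq_iff)
  have cases_F: "x l = x 0 \<and> y (Suc l mod m) = y (Suc 0 mod m) \<or>
      x l = y (Suc 0 mod m) \<and> y (Suc l mod m) = x 0" if "l < m" for l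
    using F[OF that] unfolding F_def doubleton_eq_iff .
  have x: "x l = x 0" if "l < m" for l
    using that
  proof (induction l)
    \<comment> \<open>A swap at \<open>Suc l\<close> would give
      \<open>x (Suc l) = y (Suc l)\<close>, against \<open>xy\<close>.\<close>
    case (Suc l)
    then have "x l = x 0" "y (Suc l) = y (Suc 0 mod m)"
      using cases_F[of l] neq by auto
    then show ?case using cases_F[of "Suc l"] xy[of "Suc l"] Suc.prems by auto
  qed simp
  have y: "y (Suc l mod m) = y (Suc 0 mod m)" if "l < m" for l
    using cases_F[OF that] x[OF that] neq by auto
  have "y l = y (Suc 0 mod m)" if "l < m" for l
  proof (cases l)
    case 0
    \<comment> \<open>The index 0 is the successor of \<open>m - 1\<close> modulo
      \<open>m\<close>.\<close>
    then show ?thesis using y[of "m - 1"] m by simp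
  next
    case (Suc l')
    then show ?thesis using y[of l'] that by simp
  qed
  then show ?thesis using x l m by (metis gr0I not_less0)
qed

lemma K_relD:
  assumes "c \<in> K_rel m k"
  shows "length c = m" "set c \<subseteq> {1..k}"
  using assms by (auto simp: K_rel_def)

lemma K_rel_two_entries:
  assumes "c \<in> K_rel m k" and "s \<in> set c"
  obtains s' where "s' \<in> set c" "s' \<noteq> s"
proof -
  obtain i j where "i < m" "j < m" "c ! i \<noteq> c ! j" "length c = m"
    using assms(1) by (auto simp: K_rel_def)
  then show thesis using that nth_mem by metis
qed

lemma K_relI:
  assumes "length c = m" and "set c \<subseteq> {1..k}" and "s \<in> set c" "s' \<in> set c" "s \<noteq> s'"
  shows "c \<in> K_rel m k"
  using assms unfolding K_rel_def by (auto simp: in_set_conv_nth)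

text \<open>If every two of the crossing pairs shared two elements, the encoding of \<open>e\<close>
  would be constant, and by \<open>inj\<close> so would \<open>e\<close>. Hence some two of them
  meet in at most one element, which is what the choice of \<open>k - 1\<close> distinct values from
  \<open>{1..k}\<close> requires.\<close>

lemma choice_avoiding_crossing_pairs:
  fixes X Y :: "nat \<Rightarrow> nat"
  assumes m: "m \<ge> 2" and k: "k \<ge> m + 1"
    and XY: "\<And>a. a \<in> {1..k+1} \<Longrightarrow> X a \<noteq> Y a"
    and inj: "inj_on (\<lambda>a. (X a, Y a)) {1..k+1}"
    and e: "e \<in> K_rel m (k + 1)"
  shows "\<exists>c. inj_on c {1..<k} \<and>
    (\<forall>j\<in>{1..<k}. c j \<in> {1..k} - {X (e ! (j mod m)), Y (e ! (Suc j mod m))})"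
proof -
  have in_range: "e ! l \<in> {1..k+1}" if "l < m" for l
    using K_relD[OF e] that nth_mem[of l e] by (simp add: subset_iff)
  obtain p q where pq: "p < m" "q < m" "e ! p \<noteq> e ! q"
    using e by (auto simp: K_rel_def)
  define G where "G l = {X (e ! l), Y (e ! (Suc l mod m))}" for l
  have "\<exists>l<m. \<exists>l'<m. l \<noteq> l' \<and> card (G l \<inter> G l') \<le> 1"
  proof (rule ccontr)
    assume "\<not> ?thesis"
    then have "\<not> card (G l \<inter> G l') \<le> 1" if "l < m" "l' < m" "l \<noteq> l'" for l l'
      using that by blast
    then have meet: "card (G l \<inter> G l') \<ge> 2" if "l < m" "l' < m" "l \<noteq> l'" for l l'
      using that by (metis Suc_1 not_less_eq_eq)
    have const: "X (e ! l) = X (e ! 0) \<and> Y (e ! l) = Y (e ! 0)" if "l < m" for l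
    proof (rule crossing_pairs_constant[OF m _ _ that])
      show "X (e ! l) \<noteq> Y (e ! l)" if "l < m" for l
        using XY[OF in_range[OF that]] .
    qed (use meet in \<open>simp add: G_def\<close>)
    have "e ! p = e ! q"
      using inj_onD[OF inj _ in_range[OF pq(1)] in_range[OF pq(2)]]
        const[OF pq(1)] const[OF pq(2)] by simp
    then show False using pq(3) by simp
  qed
  then obtain l l' where l: "l < m" "l' < m" "l \<noteq> l'" "card (G l \<inter> G l') \<le> 1" by blast
  \<comment> \<open>The index range starts at 1, so the residue 0 is represented by
    \<open>m\<close>, which lies below \<open>k\<close> because
    \<open>k \<ge> m + 1\<close>.\<close>
  define j where "j i = (if i = 0 then m else i)" for i :: nat
  have j: "j i \<in> {1..<k}" "j i mod m = i" if "i < m" for i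
    using that m k by (auto simp: j_def)
  have "\<exists>c. inj_on c {1..<k} \<and> (\<forall>i\<in>{1..<k}. c i \<in> {1..k} - G (i mod m))"
  proof (rule choice_avoiding_pairs[where i = "j l" and j = "j l'"])
    show "j l \<noteq> j l'" using j(2)[OF l(1)] j(2)[OF l(2)] l(3) by metis
    show "card (G (j l mod m) \<inter> G (j l' mod m)) \<le> 1" using l j(2) by simp
    show "finite (G (i mod m)) \<and> card (G (i mod m)) \<le> 2" for i
      by (simp add: G_def card_insert_if)
  qed (use j(1)[OF l(1)] j(1)[OF l(2)] in simp_all)
  then show ?thesis unfolding G_def mod_Suc_eq .
qed

section \<open>Descent from \<open>k + 1\<close> to \<open>k\<close>\<close>

text \<open>One entry below \<open>k\<close> whose value differs from \<open>v k\<close> and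
  \<open>v (k + 1)\<close> suffices, because injectivity separates it from all other entries below
  \<open>k\<close>. Without entries below \<open>k\<close>, both \<open>k\<close> and
  \<open>k + 1\<close> occur.\<close>

lemma K_rel_map:
  assumes \<tau>: "\<tau> \<in> K_rel m (k + 1)"
    and v: "v ` set \<tau> \<subseteq> {1..k}"
    and inj: "inj_on v {1..<k}"
    and c: "{1..<k} \<inter> set \<tau> \<noteq> {} \<Longrightarrow> \<exists>j\<in>{1..<k} \<inter> set \<tau>. v j \<noteq> v k \<and> v j \<noteq> v (k + 1)"
    and xy: "{1..<k} \<inter> set \<tau> = {} \<Longrightarrow> v k \<noteq> v (k + 1)"
  shows "map v \<tau> \<in> K_rel m k"
proof -
  have sub: "set \<tau> \<subseteq> {1..k+1}" using K_relD[OF \<tau>] by simp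
  have "\<exists>s\<in>set \<tau>. \<exists>s'\<in>set \<tau>. v s \<noteq> v s'"
  proof (cases "{1..<k} \<inter> set \<tau> = {}")
    case True
    obtain s where "s \<in> set \<tau>" using \<tau> by (auto simp: K_rel_def) (metis nth_mem)
    then obtain s' where "s' \<in> set \<tau>" "s' \<noteq> s" using K_rel_two_entries[OF \<tau>] by metis
    moreover have "t = k \<or> t = k + 1" if "t \<in> set \<tau>" for t
      using True sub that by fastforce
    ultimately show ?thesis using xy[OF True] \<open>s \<in> set \<tau>\<close> by metis
  next
    case False
    then obtain j where j: "j \<in> {1..<k}" "j \<in> set \<tau>" "v j \<noteq> v k" "v j \<noteq> v (k + 1)"
      using c by blast
    obtain s where s: "s \<in> set \<tau>" "s \<noteq> j" using K_rel_two_entries[OF \<tau> j(2)] by metis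
    have "s \<in> {1..<k} \<or> s = k \<or> s = k + 1" using s(1) sub by fastforce
    then have "v s \<noteq> v j" using j s(2) inj_onD[OF inj, of s j] by auto
    then show ?thesis using s(1) j(2) by blast
  qed
  then obtain s s' where "s \<in> set \<tau>" "s' \<in> set \<tau>" "v s \<noteq> v s'" by blast
  then show ?thesis
    using K_relD[OF \<tau>] v by (intro K_relI[of _ _ _ "v s" "v s'"]) auto
qed

lemma satisfies_K_rel_step:
  assumes alg: "is_algebra A" and m: "m \<ge> 2" and k: "k \<ge> m + 1"
    and cs: "set cs = K_rel m (k + 1)" and ds: "set ds = K_rel m k"
    and sat: "satisfies A (rows_of_columns m cs)"
  shows "satisfies A (rows_of_columns m ds)"
proof -
  have m1: "m \<ge> 1" using m by simp
  obtain f where f: "term_operation A (length cs) f" and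
    eq: "\<And>\<alpha> p q. range \<alpha> \<subseteq> domain A \<Longrightarrow> p < m \<Longrightarrow> q < m \<Longrightarrow>
      f (map (\<lambda>c. \<alpha> (c ! p)) cs) = f (map (\<lambda>c. \<alpha> (c ! q)) cs)"
    using sat unfolding satisfies_rows_of_columns[OF m1] by blast
  \<comment> \<open>The \<open>k + 1\<close> pairs are the edges of the directed cycle on
    \<open>1, ..., k\<close> and the additional chord from 1 to 3.\<close>
  define X where "X a = (if a = k + 1 then 1 else a)" for a
  define Y where "Y a = (if a = k + 1 then 3 else if a = k then 1 else a + 1)" for a
  have X: "X a \<in> {1..k}" and Y: "Y a \<in> {1..k}" and XY: "X a \<noteq> Y a"
    if "a \<in> {1..k+1}" for a
    using that k m by (auto simp: X_def Y_def)
  have inj: "inj_on (\<lambda>a. (X a, Y a)) {1..k+1}"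
    using k m by (auto simp: inj_on_def X_def Y_def split: if_splits)
  have "\<forall>e\<in>set cs. \<exists>c. inj_on c {1..<k} \<and>
    (\<forall>j\<in>{1..<k}. c j \<in> {1..k} - {X (e ! (j mod m)), Y (e ! (Suc j mod m))})"
    using choice_avoiding_crossing_pairs[OF m k XY inj] cs by blast
  then obtain c where c_inj: "\<And>e. e \<in> set cs \<Longrightarrow> inj_on (c e) {1..<k}" and
    c: "\<And>e j. e \<in> set cs \<Longrightarrow> j \<in> {1..<k} \<Longrightarrow>
      c e j \<in> {1..k} - {X (e ! (j mod m)), Y (e ! (Suc j mod m))}"
    by metis
  have entry: "e ! l \<in> {1..k+1}" if "e \<in> set cs" "l < m" for e l
    using K_relD[of e m "k + 1"] cs that nth_mem[of l e] by (simp add: subset_iff)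
  \<comment> \<open>The elements \<open>1, \<dots>, k - 1\<close>, \<open>k\<close> and \<open>k + 1\<close> of the larger clique stand for the \<open>c\<^sub>j\<close>, for
    \<open>X\<close> and for \<open>Y\<close>. Each column \<open>\<tau>\<close> may choose which entry of \<open>e\<close> the maps \<open>X\<close> and \<open>Y\<close>
    are applied to, because \<open>f\<close> does not see the difference.\<close>
  define val where
    "val lx ly e s = (if s < k then c e s else if s = k then X (e ! lx) else Y (e ! ly))"
    for lx ly e s
  \<comment> \<open>\<open>lx\<close> and \<open>ly\<close> may depend on \<open>\<tau>\<close> but
    not on \<open>e\<close>, since \<open>e\<close> runs over the arguments of a single application
    of \<open>f\<close>.\<close>
  have "\<forall>\<tau>\<in>set cs. \<exists>lx<m. \<exists>ly<m. \<forall>e\<in>set cs. map (val lx ly e) \<tau> \<in> K_rel m k"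
  proof
    fix \<tau> assume \<tau>: "\<tau> \<in> set cs"
    then have \<tau>K: "\<tau> \<in> K_rel m (k + 1)" using cs by simp
    have sub: "set \<tau> \<subseteq> {1..k+1}" using K_relD[OF \<tau>K] by simp
    have img: "val lx ly e ` set \<tau> \<subseteq> {1..k}" if "e \<in> set cs" "lx < m" "ly < m" for lx ly e
    proof
      fix y assume "y \<in> val lx ly e ` set \<tau>"
      then obtain s where s: "s \<in> {1..k+1}" "y = val lx ly e s" using sub by blast
      show "y \<in> {1..k}"
        using s c[OF that(1), of s] X[OF entry[OF that(1,2)]] Y[OF entry[OF that(1,3)]]
        by (auto simp: val_def)
    qed
    have val_inj: "inj_on (val lx ly e) {1..<k}" if "e \<in> set cs" for lx ly e
      using c_inj[OF that] by (auto simp: inj_on_def val_def)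
    show "\<exists>lx<m. \<exists>ly<m. \<forall>e\<in>set cs. map (val lx ly e) \<tau> \<in> K_rel m k"
    proof (cases "{1..<k} \<inter> set \<tau> = {}")
      case True
      \<comment> \<open>Here \<open>X\<close> and \<open>Y\<close> are applied to the same entry of
        \<open>e\<close>, on which they differ.\<close>
      have "map (val 0 0 e) \<tau> \<in> K_rel m k" if e: "e \<in> set cs" for e
        using True m XY[OF entry[OF e, of 0]]
        by (intro K_rel_map[OF \<tau>K img val_inj]) (auto simp: e val_def)
      then show ?thesis using m by (intro exI[of _ 0] conjI ballI) simp_all
    next
      case False
      then obtain j where j: "j \<in> {1..<k}" "j \<in> set \<tau>" by blast
      \<comment> \<open>The entries of \<open>e\<close> are picked so that \<open>c e j\<close>
        avoids the resulting values of \<open>X\<close> and \<open>Y\<close>.\<close>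
      have "map (val (j mod m) (Suc j mod m) e) \<tau> \<in> K_rel m k" if e: "e \<in> set cs" for e
        using False m j c[OF e j(1)]
        by (intro K_rel_map[OF \<tau>K img val_inj]) (auto simp: e val_def intro!: bexI[of _ j])
      moreover have "j mod m < m" "Suc j mod m < m" using m by simp_all
      ultimately show ?thesis by blast
    qed
  qed
  then obtain lx ly where lx: "\<And>\<tau>. \<tau> \<in> set cs \<Longrightarrow> lx \<tau> < m" and ly: "\<And>\<tau>. \<tau> \<in> set cs \<Longrightarrow> ly \<tau> < m"
    and val: "\<And>\<tau> e. \<tau> \<in> set cs \<Longrightarrow> e \<in> set cs \<Longrightarrow> map (val (lx \<tau>) (ly \<tau>) e) \<tau> \<in> set ds"
    unfolding ds by metis
  have "\<forall>\<tau>\<in>set cs. \<forall>e\<in>set cs. \<exists>i<length ds. ds ! i = map (val (lx \<tau>) (ly \<tau>) e) \<tau>"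
    using val by (simp add: in_set_conv_nth)
  then obtain idx where idx: "\<And>\<tau> e. \<tau> \<in> set cs \<Longrightarrow> e \<in> set cs \<Longrightarrow>
      idx \<tau> e < length ds \<and> ds ! idx \<tau> e = map (val (lx \<tau>) (ly \<tau>) e) \<tau>"
    by metis
  \<comment> \<open>The inner \<open>f\<close> runs over the encoded tuples \<open>e\<close>, the
    outer one over the columns \<open>\<tau>\<close> of the larger clique.\<close>
  define g where "g as = f (map (\<lambda>\<tau>. f (map (\<lambda>e. as ! idx \<tau> e) cs)) cs)" for as
  have "term_operation A (length ds) g"
    unfolding g_def
    by (intro term_operation_compose[OF alg f] term_operation_nth) (simp add: idx)
  moreover have "g (map (\<lambda>d. \<alpha> (d ! p)) ds) = g (map (\<lambda>d. \<alpha> (d ! q)) ds)"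
    if \<alpha>: "range \<alpha> \<subseteq> domain A" and pq: "p < m" "q < m" for \<alpha> p q
  proof -
    define \<beta> where "\<beta> s = f (map (\<lambda>e. \<alpha> (val 0 0 e s)) cs)" for s
    have \<beta>_range: "range \<beta> \<subseteq> domain A"
      using term_operation_in_domain[OF alg f] \<alpha> unfolding \<beta>_def by (auto simp: image_subset_iff)
    \<comment> \<open>For \<open>s < k\<close> neither index matters. Otherwise the loop condition
      for \<open>f\<close> under \<open>\<alpha> \<circ> X\<close> or
      \<open>\<alpha> \<circ> Y\<close> moves the index to 0.\<close>
    have \<beta>: "f (map (\<lambda>e. \<alpha> (val l l' e s)) cs) = \<beta> s" if "l < m" "l' < m" for l l' s
    proof -
      have "range (\<alpha> \<circ> X) \<subseteq> domain A" "range (\<alpha> \<circ> Y) \<subseteq> domain A" using \<alpha> by auto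
      from eq[OF this(1), of l 0] eq[OF this(2), of l' 0] show ?thesis
        using that m by (cases "s < k"; cases "s = k") (simp_all add: \<beta>_def val_def)
    qed
    have g: "g (map (\<lambda>d. \<alpha> (d ! p)) ds) = f (map (\<lambda>\<tau>. \<beta> (\<tau> ! p)) cs)" if p: "p < m" for p
    proof -
      have "f (map (\<lambda>e. map (\<lambda>d. \<alpha> (d ! p)) ds ! idx \<tau> e) cs) = \<beta> (\<tau> ! p)"
        if \<tau>: "\<tau> \<in> set cs" for \<tau>
      proof -
        have "length \<tau> = m" using \<tau> K_relD cs by blast
        then have "map (\<lambda>e. map (\<lambda>d. \<alpha> (d ! p)) ds ! idx \<tau> e) cs
            = map (\<lambda>e. \<alpha> (val (lx \<tau>) (ly \<tau>) e (\<tau> ! p))) cs"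
          using idx[OF \<tau>] p by simp
        then show ?thesis by (simp only: \<beta>[OF lx[OF \<tau>] ly[OF \<tau>]])
      qed
      then show ?thesis unfolding g_def by (intro arg_cong[of _ _ f] map_cong) simp_all
    qed
    show ?thesis using g[OF pq(1)] g[OF pq(2)] eq[OF \<beta>_range pq] by simp
  qed
  ultimately show ?thesis unfolding satisfies_rows_of_columns[OF m1] by blast
qed

lemma satisfies_K_rel_descend:
  assumes alg: "is_algebra A" and m: "m \<ge> 2" and k: "k \<ge> m + 1"
    and cs: "set cs = K_rel m (k + d)" and ds: "set ds = K_rel m k"
    and sat: "satisfies A (rows_of_columns m cs)"
  shows "satisfies A (rows_of_columns m ds)"
  using cs sat
proof (induction d arbitrary: cs)
  case 0
  \<comment> \<open>The two lists may enumerate the same relation differently, so the identity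
    homomorphism is used.\<close>
  have "map id c \<in> set ds" if "c \<in> set cs" for c using that 0(1) ds by simp
  then show ?case
    using satisfies_rows_of_columns_hom[OF alg _ _ _ 0(2), of id ds] m 0(1) K_relD(1) by fastforce
next
  case (Suc d)
  obtain bs where bs: "set bs = K_rel m (k + d)" using finite_list[OF finite_K_rel] by blast
  then have "satisfies A (rows_of_columns m bs)"
    using satisfies_K_rel_step[OF alg m, of "k + d" cs bs] Suc.prems k by simp
  then show ?case using Suc.IH bs by blast
qed

section \<open>Non-trivial conditions and the conclusion\<close>

text \<open>If column \<open>i\<close> were constant, the projection to coordinate \<open>i\<close>
  would satisfy \<open>C\<close> even in an algebra without operations.\<close>

lemma nontrivial_column:
  assumes C: "loop_condition n m C" and nt: "nontrivial C" and i: "i < n"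
  shows "\<exists>r\<in>set C. \<exists>r'\<in>set C. r ! i \<noteq> r' ! i"
proof (rule ccontr)
  assume "\<not> ?thesis"
  then have col: "r ! i = r' ! i" if "r \<in> set C" "r' \<in> set C" for r r' using that by blast
  have len: "length r = n" if "r \<in> set C" for r using C that by (simp add: loop_condition_def)
  have "C \<noteq> []" using C by (auto simp: loop_condition_def)
  then have arity: "loop_arity C = n" using len by simp
  define N :: "(nat, nat) ualg" where
    "N = \<lparr>domain = UNIV, symbols = {}, op_arity = (\<lambda>_. 0), op_interp = (\<lambda>_ _. 0)\<rparr>"
  have "projection_algebra N" by (simp add: N_def projection_algebra_def is_algebra_def)
  moreover have "\<exists>a\<in>domain N. \<exists>b\<in>domain N. a \<noteq> b"
    by (rule bexI[of _ 0], rule bexI[of _ 1]) (simp_all add: N_def)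
  moreover have "satisfies N C"
    unfolding satisfies_def arity
  proof (intro exI conjI allI impI ballI)
    show "term_operation N n (\<lambda>as. as ! i)" by (rule term_operation_nth[OF i])
    show "map \<alpha> r ! i = map \<alpha> r' ! i" if "r \<in> set C" "r' \<in> set C" for \<alpha> r r'
      using col[OF that] i len that by simp
  qed
  ultimately show False using nt unfolding nontrivial_def by blast
qed

theorem corollary3p7:
  fixes A :: "('f, 'a) ualg" and C :: "'v list list" and m n :: nat
  assumes "is_algebra A"
    and "m \<ge> 2"
    and "loop_condition n m C"
    and "nontrivial C"
    and "satisfies A C"
  shows "\<forall>L \<in> L_conditions m (max 4 (m + 1)). satisfies A L"
proof
  let ?k = "max 4 (m + 1)"
  fix L assume "L \<in> L_conditions m ?k"
  then obtain ds where L: "L = rows_of_columns m ds" and ds: "set ds = K_rel m ?k"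
    by (auto simp: L_conditions_def)
  have lenC: "length C = m" and len: "\<And>r. r \<in> set C \<Longrightarrow> length r = n"
    using assms(3) by (simp_all add: loop_condition_def)
  define col where "col i = map (\<lambda>r. r ! i) C" for i
  have C: "rows_of_columns m (map col [0..<n]) = C"
    unfolding rows_of_columns_def
    by (rule nth_equalityI) (auto simp: lenC col_def len intro!: nth_equalityI)
  define V where "V = \<Union> (set ` set C)"
  have "finite V" by (simp add: V_def)
  then obtain h where h: "bij_betw h V {1..card V}"
    using ex_bij_betw_finite_nat finite_same_card_bij[of V "{1..card V}"] by fastforce
  \<comment> \<open>The size \<open>?k + card V\<close> has room for the image of \<open>h\<close>
    and is of the form from which the descent reaches \<open>?k\<close>.\<close>
  obtain cs where cs: "set cs = K_rel m (?k + card V)" using finite_list[OF finite_K_rel] by blast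
  have "map h (col i) \<in> K_rel m (?k + card V)" if i: "i < n" for i
  proof -
    obtain r r' where r: "r \<in> set C" "r' \<in> set C" "r ! i \<noteq> r' ! i"
      using nontrivial_column[OF assms(3,4) i] by blast
    have V: "r ! i \<in> V" if "r \<in> set C" for r
      using that i len[OF that] nth_mem unfolding V_def by blast
    then have "set (map h (col i)) \<subseteq> {1..?k + card V}"
      using bij_betw_apply[OF h] by (fastforce simp: col_def)
    moreover have "h (r ! i) \<noteq> h (r' ! i)"
      using r V h by (metis bij_betw_inv_into_left)
    ultimately show ?thesis
      using r lenC by (intro K_relI[of _ _ _ "h (r ! i)" "h (r' ! i)"]) (auto simp: col_def)
  qed
  then have "satisfies A (rows_of_columns m cs)"
    using assms(2,5) lenC cs
    by (intro satisfies_rows_of_columns_hom[OF assms(1), of m "map col [0..<n]" h])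
      (auto simp: C col_def)
  then show "satisfies A L"
    unfolding L using satisfies_K_rel_descend[OF assms(1,2) _ cs ds] by simp
qed

end
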